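(* If $(x,y)=(1,1)$ is the unique solution in positive integers of the equation $2x^{3}-y^{3}=1$, then there is a unique cubic-triangular number, namely $1$; that is, the only pair $(n,m)$ of positive integers with $\frac{n(n+1)}{2}=m^{3}$ is $(n,m)=(1,1)$.
   Context: The $n$-th triangular number is $T_{n}=\frac{n(n+1)}{2}$. A cubic-triangular number is a positive integer that is simultaneously a cube and a triangular number, i.e. a number of the form $T_{n}=m^{3}$ for some positive integers $n$ and $m$. *)

theory Defs
  imports "HOL-Library.Nat_Bijection"
begin

text \<open>The \<open>n\<close>-th triangular number is \<^const>\<open>triangle\<close> \<open>n\<close>, i.e. \<open>n * Suc n div 2\<close>; the division
  is exact.\<close>

definition cubic_triangular :: "nat \<Rightarrow> bool" where
  "cubic_triangular k \<longleftrightarrow> (\<exists>n m. n > 0 \<and> m > 0 \<and> k = triangle n \<and> triangle n = m ^ 3)"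

end

theory Submission
  imports Defs Complex_Main "HOL-Computational_Algebra.Nth_Powers"
begin

text \<open>
  Write \<open>T\<^sub>n = m\<^sup>3\<close> and split on the parity of \<open>n\<close>. If \<open>n = 2 k - 1\<close>, then \<open>k\<close> and \<open>2 k - 1\<close> are
  coprime with product \<open>m\<^sup>3\<close>, hence cubes, and the hypothesis applies. If \<open>n = 2 k\<close>, one gets
  \<open>a\<^sup>3 - 2 b\<^sup>3 = 1\<close> with \<open>a, b > 0\<close>, which the hypothesis does not cover because it only speaks
  about positive solutions of \<open>2 x\<^sup>3 - y\<^sup>3 = 1\<close>. Let \<open>\<theta>\<close> be the cube root of \<open>2\<close>. Then \<open>a - b \<theta>\<close> is
  a unit of norm \<open>1\<close> in \<open>(0, 1)\<close>, so it is a power \<open>\<epsilon>\<^sup>n\<close> of \<open>\<epsilon> = \<theta> - 1\<close>, because no unit of norm \<open>1\<close>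
  lies strictly between \<open>1\<close> and \<open>1/\<epsilon>\<close>. Since \<open>\<epsilon>\<^sup>3 = 1 + 3 (\<theta> - \<theta>\<^sup>2)\<close>, a 3-adic expansion of \<open>\<epsilon>\<^sup>n\<close>
  shows that its \<open>\<theta>\<^sup>2\<close>-coefficient vanishes only for \<open>n = 0\<close> and \<open>n = 1\<close>.
\<close>

section \<open>The ring of integers of the pure cubic field of 2\<close>

text \<open>The triple \<open>(a, b, c)\<close> stands for \<open>a + b \<theta> + c \<theta>\<^sup>2\<close> with \<open>\<theta>\<^sup>3 = 2\<close>.\<close>

type_synonym cubic = "int \<times> int \<times> int"

fun cmul :: "cubic \<Rightarrow> cubic \<Rightarrow> cubic" where
  "cmul (a, b, c) (a', b', c') =
    (a * a' + 2 * (b * c' + c * b'), a * b' + b * a' + 2 * c * c', a * c' + b * b' + c * a')"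

fun cnorm :: "cubic \<Rightarrow> int" where
  "cnorm (a, b, c) = a ^ 3 + 2 * b ^ 3 + 4 * c ^ 3 - 6 * a * b * c"

abbreviation cbrt2 :: real ("\<theta>") where "\<theta> \<equiv> root 3 2"

fun cval :: "cubic \<Rightarrow> real" where
  "cval (a, b, c) = a + b * \<theta> + c * \<theta>\<^sup>2"

text \<open>The inverse of \<theta> - 1 is \<open>(1, 1, 1)\<close>, since \<theta>^3 - 1 =
  1.\<close>

primrec eps_pow :: "nat \<Rightarrow> cubic" where
  "eps_pow 0 = (1, 0, 0)"
| "eps_pow (Suc n) = cmul (-1, 1, 0) (eps_pow n)"

lemma cmul_assoc: "cmul (cmul x y) z = cmul x (cmul y z)"
  by (cases x; cases y; cases z) (simp add: algebra_simps)

lemma cmul_one [simp]: "cmul (1, 0, 0) x = x"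
  by (cases x) simp

lemma eps_pow_add: "eps_pow (m + n) = cmul (eps_pow m) (eps_pow n)"
  by (induction m) (simp_all add: cmul_assoc)

lemma cbrt2_cube: "\<theta> ^ 3 = 2"
  by simp

lemma cbrt2_bounds: "1.25 < \<theta>" "\<theta> < 1.26"
proof -
  show "1.25 < \<theta>"
    by (rule power_less_imp_less_base[of _ 3], unfold cbrt2_cube) (simp_all add: power3_eq_cube)
  show "\<theta> < 1.26"
    by (rule power_less_imp_less_base[of _ 3], unfold cbrt2_cube) (simp_all add: power3_eq_cube)
qed

lemma cbrt2_sq_bounds: "1.56 < \<theta>\<^sup>2" "\<theta>\<^sup>2 < 1.59"
proof -
  have "1.25 * 1.25 \<le> \<theta> * \<theta>" "\<theta> * \<theta> \<le> 1.26 * 1.26"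
    using cbrt2_bounds by (intro mult_mono; simp)+
  then show "1.56 < \<theta>\<^sup>2" "\<theta>\<^sup>2 < 1.59"
    by (simp_all add: power2_eq_square)
qed

lemma cval_cmul: "cval (cmul x y) = cval x * cval y"
proof -
  obtain a b c a' b' c' where [simp]: "x = (a, b, c)" "y = (a', b', c')"
    by (metis prod_cases3)
  have "cval x * cval y = a * a' + (a * b' + b * a') * \<theta> + (a * c' + b * b' + c * a') * \<theta>\<^sup>2
      + (b * c' + c * b') * \<theta> ^ 3 + c * c' * (\<theta> ^ 3 * \<theta>)"
    by (simp add: algebra_simps power2_eq_square power3_eq_cube)
  then show ?thesis
    unfolding cbrt2_cube by (simp add: algebra_simps)
qed

section \<open>Units of norm one\<close>

text \<open>The conjugates have product \<open>1 / v\<close>, at most 1. This bounds all three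
  coefficients and leaves finitely many triples.\<close>

lemma unit_norm_one_fundamental_domain:
  assumes norm: "cnorm (a, b, c) = 1"
    and ge: "1 \<le> cval (a, b, c)" and less: "cval (a, b, c) < cval (1, 1, 1)"
  shows "(a, b, c) = (1, 0, 0)"
proof -
  define v where "v = cval (a, b, c)"
  define p q where "p = a - b * \<theta>" and "q = a - c * \<theta>\<^sup>2"
  \<comment> \<open>\<open>Q\<close> is the product of the two conjugates of \<open>v\<close>.\<close>
  define Q where "Q = p\<^sup>2 + q\<^sup>2 - p * q"
  have "v * Q = of_int a ^ 3 + of_int b ^ 3 * \<theta> ^ 3 + of_int c ^ 3 * (\<theta> ^ 3) ^ 2 - 3 * a * b * c * \<theta> ^ 3"
    unfolding v_def Q_def p_def q_def cval.simps of_int_mult of_int_numeral by algebra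
  also have "\<dots> = of_int (cnorm (a, b, c))"
    unfolding cbrt2_cube by simp
  finally have vQ: "v * Q = 1"
    by (simp only: norm of_int_1)
  have v: "1 \<le> v" "v < 4"
    using ge less cbrt2_bounds cbrt2_sq_bounds by (simp_all add: v_def)
  have "Q \<le> 1"
  proof (rule ccontr)
    assume "\<not> Q \<le> 1"
    then have "1 * Q \<le> v * Q"
      using v by (intro mult_right_mono) auto
    then show False
      using vQ \<open>\<not> Q \<le> 1\<close> by simp
  qed
  \<comment> \<open>Completing the square in three ways bounds the linear forms that, added to
    \<open>v\<close>, isolate \<open>3 * a\<close>, \<open>3 * (b * \<theta>)\<close> and
    \<open>3 * (c * \<theta>\<^sup>2)\<close>.\<close>
  moreover have "(p + q)\<^sup>2 + 3 * (p - q)\<^sup>2 = 4 * Q" "(q - 2 * p)\<^sup>2 + 3 * q\<^sup>2 = 4 * Q"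
    "(p - 2 * q)\<^sup>2 + 3 * p\<^sup>2 = 4 * Q"
    by (simp_all add: Q_def power2_eq_square algebra_simps)
  moreover have "0 \<le> (p - q)\<^sup>2" "0 \<le> q\<^sup>2" "0 \<le> p\<^sup>2"
    by simp_all
  ultimately have "(p + q)\<^sup>2 \<le> 4" "(q - 2 * p)\<^sup>2 \<le> 4" "(p - 2 * q)\<^sup>2 \<le> 4"
    by linarith+
  then have "\<bar>p + q\<bar> \<le> 2" "\<bar>q - 2 * p\<bar> \<le> 2" "\<bar>p - 2 * q\<bar> \<le> 2"
    using abs_le_square_iff[of _ "2 :: real"] by simp_all
  moreover have "3 * a = v + (p + q)" "3 * (b * \<theta>) = v + (q - 2 * p)" "3 * (c * \<theta>\<^sup>2) = v + (p - 2 * q)"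
    by (simp_all add: v_def p_def q_def algebra_simps)
  ultimately have a: "-2 < 3 * real_of_int a" "3 * real_of_int a < 6"
    and b: "-2 < 3 * (b * \<theta>)" "3 * (b * \<theta>) < 6"
    and c: "-2 < 3 * (c * \<theta>\<^sup>2)" "3 * (c * \<theta>\<^sup>2) < 6"
    using v by linarith+
  have small: "x \<in> {0, 1}" if "-2 < 3 * (x * r)" "3 * (x * r) < 6" "1 \<le> r" for x :: int and r :: real
  proof -
    have "\<not> x \<le> -1"
    proof
      assume "x \<le> -1"
      then have "x * r \<le> -1 * r"
        using that(3) by (intro mult_right_mono) auto
      then show False using that by linarith
    qed
    moreover have "\<not> x \<ge> 2"
    proof
      assume "x \<ge> 2"
      then have "2 * r \<le> x * r"
        using that(3) by (intro mult_right_mono) auto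
      then show False using that by linarith
    qed
    ultimately show ?thesis by auto
  qed
  have "a \<in> {0, 1}" "b \<in> {0, 1}" "c \<in> {0, 1}"
    using small[of a 1] small[OF b] small[OF c] a cbrt2_bounds cbrt2_sq_bounds by simp_all
  \<comment> \<open>Of the eight triples only \<open>(1, 0, 0)\<close> and \<open>(1, 1, 1)\<close>
    have norm 1; \<open>less\<close> is strict and excludes the latter.\<close>
  then show ?thesis
    using norm less by auto
qed

text \<open>Multiplying by \<open>(1, 1, 1)\<close> moves the value up into the fundamental domain;
  \<open>n\<close> bounds the number of multiplications.\<close>

lemma unit_norm_one_eq_eps_pow:
  assumes "cnorm x = 1" "1 \<le> cval x * cval (1, 1, 1) ^ n" "cval x < cval (1, 1, 1)"
  shows "\<exists>k. x = eps_pow k"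
  using assms
proof (induction n arbitrary: x)
  case 0
  then have "x = (1, 0, 0)"
    using unit_norm_one_fundamental_domain by (cases x) (simp del: cnorm.simps cval.simps)
  then show ?case
    by (metis eps_pow.simps(1))
next
  case (Suc n)
  show ?case
  proof (cases "1 \<le> cval x")
    case True
    then have "x = (1, 0, 0)"
      using Suc.prems unit_norm_one_fundamental_domain
      by (cases x) (simp del: cnorm.simps cval.simps)
    then show ?thesis
      by (metis eps_pow.simps(1))
  next
    case False
    let ?y = "cmul x (1, 1, 1)"
    have pos: "cval (1, 1, 1) > 0"
      using cbrt2_bounds cbrt2_sq_bounds by simp
    have "cnorm ?y = cnorm x"
      by (cases x) (simp add: power3_eq_cube algebra_simps)
    moreover have "1 \<le> cval ?y * cval (1, 1, 1) ^ n"
      using Suc.prems(2) by (simp only: cval_cmul power_Suc mult.assoc)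
    moreover have "cval ?y < cval (1, 1, 1)"
      using False pos by (simp only: cval_cmul) (simp del: cval.simps)
    ultimately obtain k where "?y = eps_pow k"
      using Suc.IH[of ?y] Suc.prems(1) by auto
    then have "eps_pow (Suc k) = cmul (-1, 1, 0) ?y"
      by simp
    also have "\<dots> = x"
      by (cases x) simp
    finally show ?thesis
      by metis
  qed
qed

section \<open>Powers of the fundamental unit, 3-adically\<close>

text \<open>This encodes the congruence of \<open>x\<close> to 1 + q s (\<theta> - \<theta>^2)
  modulo 3 q.\<close>

definition eps_cong :: "int \<Rightarrow> int \<Rightarrow> cubic \<Rightarrow> bool" where
  "eps_cong q s x \<longleftrightarrow> (\<exists>a b c. x = (1 + 3 * q * a, q * (s + 3 * b), q * (3 * c - s)))"

text \<open>The cross term carries q^2, which vanishes modulo 3 q because 3 divides q.\<close>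

lemma eps_cong_cmul:
  assumes "3 dvd q" "eps_cong q s x" "eps_cong q s' y"
  shows "eps_cong q (s + s') (cmul x y)"
proof -
  obtain p where q: "q = 3 * p"
    using assms(1) by blast
  obtain a b c where x: "x = (1 + 3 * q * a, q * (s + 3 * b), q * (3 * c - s))"
    using assms(2) by (auto simp: eps_cong_def)
  obtain a' b' c' where y: "y = (1 + 3 * q * a', q * (s' + 3 * b'), q * (3 * c' - s'))"
    using assms(3) by (auto simp: eps_cong_def)
  define B C B' C' where "B = s + 3 * b" "C = 3 * c - s" "B' = s' + 3 * b'" "C' = 3 * c' - s'"
  note defs = this
  have "cmul x y = (1 + 3 * q * (a + a' + 3 * q * a * a' + 2 * p * (B * C' + C * B')),
      q * (s + s' + 3 * (b + b' + q * a * B' + q * a' * B + 2 * p * C * C')),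
      q * (3 * (c + c' + q * a * C' + q * a' * C + p * B * B') - (s + s')))"
    unfolding x y defs[symmetric] cmul.simps
    by (simp add: q) (simp add: defs algebra_simps)
  then show ?thesis
    unfolding eps_cong_def by blast
qed

lemma eps_cong_cube:
  assumes "3 dvd q" "eps_cong q s x"
  shows "eps_cong (3 * q) s (cmul x (cmul x x))"
proof -
  obtain p where q: "q = 3 * p"
    using assms(1) by blast
  obtain a b c where x: "x = (1 + 3 * q * a, q * (s + 3 * b), q * (3 * c - s))"
    using assms(2) by (auto simp: eps_cong_def)
  define A B C where "A = 3 * a" "B = s + 3 * b" "C = 3 * c - s"
  note defs = this
  \<comment> \<open>With \<open>g = (A, B, C)\<close>: \<open>(1 + q g)\<^sup>3 = 1 + 3 q g + 9 q p g\<^sup>2 + 9 q p\<^sup>2 g\<^sup>3\<close>.\<close>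
  obtain A2 B2 C2 where g2: "cmul (A, B, C) (A, B, C) = (A2, B2, C2)"
    by (metis prod_cases3)
  obtain A3 B3 C3 where g3: "cmul (A, B, C) (A2, B2, C2) = (A3, B3, C3)"
    by (metis prod_cases3)
  have "x = (1 + q * A, q * B, q * C)"
    by (simp add: x defs)
  then have "cmul x (cmul x x) =
      (1 + 3 * q * A + 9 * q * p * A2 + 9 * q * p\<^sup>2 * A3,
       3 * q * B + 9 * q * p * B2 + 9 * q * p\<^sup>2 * B3,
       3 * q * C + 9 * q * p * C2 + 9 * q * p\<^sup>2 * C3)"
    using g2 g3 by (auto simp: q algebra_simps power2_eq_square)
  also have "\<dots> = (1 + 3 * (3 * q) * (a + p * A2 + p\<^sup>2 * A3),
       3 * q * (s + 3 * (b + p * B2 + p\<^sup>2 * B3)), 3 * q * (3 * (c + p * C2 + p\<^sup>2 * C3) - s))"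
    by (simp add: defs algebra_simps)
  finally show ?thesis
    unfolding eps_cong_def by blast
qed

lemma eps_cong_eps_pow_power3: "eps_cong (3 ^ Suc r) 1 (eps_pow (3 ^ Suc r))"
proof (induction r)
  case 0
  have "eps_pow 3 = (1 + 3 * 3 * 0, 3 * (1 + 3 * 0), 3 * (3 * 0 - 1))"
    by (simp add: numeral_3_eq_3)
  then show ?case
    unfolding eps_cong_def by (metis power_one_right One_nat_def)
next
  case (Suc r)
  have "(3::nat) ^ Suc (Suc r) = 3 ^ Suc r + (3 ^ Suc r + 3 ^ Suc r)"
    by simp
  then show ?case
    using eps_cong_cube[OF _ Suc.IH] by (simp only: eps_pow_add) simp
qed

lemma eps_cong_eps_pow: "eps_cong (3 ^ Suc r) (int s) (eps_pow (3 ^ Suc r * s))"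
proof (induction s)
  case 0
  show ?case
    by (auto simp: eps_cong_def intro: exI[of _ 0])
next
  case (Suc s)
  have "eps_cong (3 ^ Suc r) (1 + int s) (cmul (eps_pow (3 ^ Suc r)) (eps_pow (3 ^ Suc r * s)))"
    by (rule eps_cong_cmul[OF _ eps_cong_eps_pow_power3 Suc.IH]) simp
  then show ?case
    by (simp only: eps_pow_add mult_Suc_right of_nat_Suc)
qed

text \<open>For \<open>n = i + 3 * m\<close> with \<open>m = 3 ^ r * s > 0\<close>, the coefficient
  is -q s or 2 q s modulo 3 q when \<open>i\<close> is 0 or 1, and 1 modulo 3 when \<open>i\<close>
  is 2.\<close>

lemma eps_pow_theta_sq_coeff_eq_0:
  assumes "eps_pow n = (a, b, 0)"
  shows "n \<le> 1"
proof (rule ccontr)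
  assume "\<not> n \<le> 1"
  define m i where "m = n div 3" and "i = n mod 3"
  have n: "n = i + 3 * m" and i: "i = 0 \<or> i = 1 \<or> i = 2"
    by (auto simp: m_def i_def)
  show False
  proof (cases "m = 0")
    case True
    then have "n = Suc (Suc 0)"
      using n i \<open>\<not> n \<le> 1\<close> by auto
    then show False
      using assms by simp
  next
    case False
    then obtain r s where m: "m = 3 ^ r * s" and s: "\<not> 3 dvd s"
      using multiplicity_decompose'[of m 3] by (metis nat_dvd_1_iff_1 numeral_eq_one_iff semiring_norm(86))
    define q :: int where "q = 3 ^ Suc r"
    obtain a' b' c' where pow: "eps_pow (3 * m) = (1 + 3 * q * a', q * (int s + 3 * b'), q * (3 * c' - int s))"
      using eps_cong_eps_pow[of r s] by (auto simp: eps_cong_def q_def m mult.assoc)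
    have q: "q \<noteq> 0" "3 dvd q"
      by (simp_all add: q_def)
    have s': "\<not> 3 dvd int s"
      using s by presburger
    from i show False
    proof (elim disjE)
      assume "i = 0"
      then have "3 * c' - int s = 0"
        using assms pow q by (simp add: n)
      then show False
        using s' by presburger
    next
      assume "i = 1"
      then have "q * (int s + 3 * b') = q * (3 * c' - int s)"
        using assms pow by (simp add: n)
      then have "int s + 3 * b' = 3 * c' - int s"
        using q by simp
      then show False
        using s' by presburger
    next
      assume "i = 2"
      then have "1 + 3 * q * a' - 2 * (q * (int s + 3 * b')) + q * (3 * c' - int s) = 0"
        using assms pow by (simp add: n numeral_2_eq_2)
      then have "1 = q * (2 * (int s + 3 * b') - 3 * a' - (3 * c' - int s))"
        by (simp add: algebra_simps)
      then have "q dvd 1"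
        by (rule dvdI)
      then show False
        using q(2) dvd_trans[of 3 q 1] by simp
    qed
  qed
qed

lemma cube_ne_twice_cube_plus_one:
  fixes a b :: int
  assumes "a > 0" "b > 0"
  shows "a ^ 3 \<noteq> 2 * b ^ 3 + 1"
proof
  assume eq: "a ^ 3 = 2 * b ^ 3 + 1"
  let ?x = "(a, -b, 0) :: cubic"
  have "(b * \<theta>) ^ 3 < real_of_int a ^ 3"
    using arg_cong[OF eq, of real_of_int] by (simp add: power_mult_distrib)
  then have pos: "0 < cval ?x"
    using assms(1) power_less_imp_less_base[of "b * \<theta>" 3 "real_of_int a"] by simp
  have eta: "cval (1, 1, 1) > 1"
    using cbrt2_bounds cbrt2_sq_bounds by simp
  obtain n where "inverse (cval ?x) < cval (1, 1, 1) ^ n"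
    using real_arch_pow[OF eta] by blast
  then have "1 \<le> cval ?x * cval (1, 1, 1) ^ n"
    using pos by (simp add: field_simps del: cval.simps)
  moreover have "cval ?x < cval (1, 1, 1)"
  proof -
    have "real_of_int a ^ 3 \<le> (b * \<theta> + 1) ^ 3"
    proof -
      have "(b * \<theta> + 1) ^ 3 = b ^ 3 * \<theta> ^ 3 + 1 + 3 * (b * \<theta>) * (b * \<theta> + 1)"
        by (simp add: power3_eq_cube algebra_simps)
      moreover have "0 \<le> 3 * (b * \<theta>) * (b * \<theta> + 1)"
        using assms(2) cbrt2_bounds by simp
      ultimately show ?thesis
        using arg_cong[OF eq, of real_of_int] by simp
    qed
    \<comment> \<open>\<open>power_le_imp_le_base\<close> compares powers with exponent
      \<open>Suc n\<close>, so the instance 2 stands for cubes.\<close>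
    then have "a \<le> b * \<theta> + 1"
      using power_le_imp_le_base[of "real_of_int a" 2 "b * \<theta> + 1"] assms(2) cbrt2_bounds
      by (simp add: numeral_3_eq_3)
    then show ?thesis
      using eta cbrt2_bounds cbrt2_sq_bounds by simp
  qed
  ultimately obtain k where k: "?x = eps_pow k"
    using unit_norm_one_eq_eps_pow[of ?x n] eq by auto
  then have "k = 0 \<or> k = 1"
    using eps_pow_theta_sq_coeff_eq_0[of k a "-b"] by auto
  \<comment> \<open>The two exponents would force \<open>b = 0\<close> or
    \<open>a = -1\<close>.\<close>
  then show False
    using k assms by auto
qed

section \<open>Cubic-triangular numbers\<close>

lemma coprime_mult_eq_cubeE:
  fixes x y m :: nat
  assumes "coprime x y" "x * y = m ^ 3"
  obtains a b where "x = a ^ 3" "y = b ^ 3"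
proof -
  have "is_nth_power 3 (x * y)"
    unfolding assms(2) by simp
  then have "is_nth_power 3 x \<and> is_nth_power 3 y"
    using is_nth_power_mult_coprime_nat_iff[OF assms(1)] by simp
  then show thesis
    using that by (auto simp: is_nth_power_def)
qed

lemma triangle_eq_cube_imp_eq_1:
  fixes n m :: nat
  assumes unique: "\<And>x y :: int. \<lbrakk>x > 0; y > 0; 2 * x ^ 3 - y ^ 3 = 1\<rbrakk> \<Longrightarrow> x = 1"
    and n: "n > 0" and eq: "triangle n = m ^ 3"
  shows "n = 1"
proof (cases "even n")
  case True
  then obtain k where k: "n = 2 * k" by blast
  have "coprime k (2 * k + 1)"
    by (rule coprimeI) (metis add_diff_cancel_left' dvd_diff_nat dvd_mult)
  moreover have "k * (2 * k + 1) = m ^ 3"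
    using eq by (simp add: triangle_def k)
  ultimately obtain b a where ab: "k = b ^ 3" "2 * k + 1 = a ^ 3"
    by (rule coprime_mult_eq_cubeE)
  then have "a > 0" "b > 0"
    using n k by (auto intro!: Nat.gr0I)
  moreover have "int a ^ 3 = 2 * int b ^ 3 + 1"
    using ab by (metis of_nat_1 of_nat_add of_nat_mult of_nat_numeral of_nat_power)
  \<comment> \<open>The even case is contradictory.\<close>
  ultimately show ?thesis
    using cube_ne_twice_cube_plus_one[of "int a" "int b"] by simp
next
  case False
  then obtain k where k: "n = 2 * k + 1"
    by (rule oddE)
  have "coprime (Suc k) n"
  proof (rule coprimeI)
    fix d assume "d dvd Suc k" "d dvd n"
    then show "d dvd 1"
      using dvd_diff_nat[of d "2 * Suc k" n] dvd_mult[of d "Suc k" 2] by (simp add: k)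
  qed
  moreover have "Suc k * n = m ^ 3"
    using eq by (simp add: triangle_def k algebra_simps)
  ultimately obtain x y where xy: "Suc k = x ^ 3" "n = y ^ 3"
    by (rule coprime_mult_eq_cubeE)
  then have "x > 0" "y > 0"
    using n by (auto intro!: Nat.gr0I)
  \<comment> \<open>This is \<open>2 * Suc k = n + 1\<close>.\<close>
  moreover have "2 * x ^ 3 = y ^ 3 + 1"
    using xy k by simp
  then have "2 * int x ^ 3 - int y ^ 3 = 1"
    by (metis add_diff_cancel_left' of_nat_1 of_nat_add of_nat_mult of_nat_numeral of_nat_power)
  ultimately have "int x = 1"
    using unique[of "int x" "int y"] by simp
  then show ?thesis
    using xy k by simp
qed

theorem corollary2:
  assumes "{(x :: int, y :: int). x > 0 \<and> y > 0 \<and> 2 * x ^ 3 - y ^ 3 = 1} = {(1, 1)}"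
  shows "{k. cubic_triangular k} = {1} \<and>
    {(n :: nat, m :: nat). n > 0 \<and> m > 0 \<and> triangle n = m ^ 3} = {(1, 1)}"
proof -
  have unique: "x = 1" if "x > 0" "y > 0" "2 * x ^ 3 - y ^ 3 = 1" for x y :: int
    using assms that by blast
  have tri: "n > 0 \<and> m > 0 \<and> triangle n = m ^ 3 \<longleftrightarrow> n = 1 \<and> m = 1" for n m :: nat
  proof
    assume *: "n > 0 \<and> m > 0 \<and> triangle n = m ^ 3"
    then have "n = 1"
      using triangle_eq_cube_imp_eq_1[of n m] unique by blast
    moreover have "m ^ 3 = 1"
      using * \<open>n = 1\<close> by (auto simp: triangle_def)
    ultimately show "n = 1 \<and> m = 1"
      by simp
  qed (simp add: triangle_def)
  have "cubic_triangular k \<longleftrightarrow> k = 1" for k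
  proof -
    have "cubic_triangular k \<longleftrightarrow> (\<exists>n m. k = triangle n \<and> (n > 0 \<and> m > 0 \<and> triangle n = m ^ 3))"
      by (auto simp: cubic_triangular_def)
    also have "\<dots> \<longleftrightarrow> k = 1"
      unfolding tri by (simp add: triangle_def)
    finally show ?thesis .
  qed
  then show ?thesis
    using tri by auto
qed

end
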